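(* Let $H$ be a mixed Hodge structure. Then $\alpha(H)\geq 0$.
   Context: A mixed Hodge structure $H$ is a finite-dimensional $\mathbf{Q}$-vector space $H_{\mathbf Q}$ with a finite increasing filtration $W_\bullet$ (weight filtration; also written $W_\bullet$ on $H_{\mathbf C}=H_{\mathbf Q}\otimes\mathbf{C}$) and a finite decreasing filtration $F^\bullet$ of $H_{\mathbf C}$ (Hodge filtration) such that $F^\bullet$ induces on each $Gr^W_nH_{\mathbf C}$ a pure Hodge structure of weight $n$. $\overline F^\bullet$ denotes the filtration complex conjugate to $F^\bullet$ with respect to the real structure $H_{\mathbf R}=H_{\mathbf Q}\otimes\mathbf{R}$. Put $$h^{p,q}_H=\dim_{\mathbf C}Gr^q_{\overline F}Gr^p_FGr^W_{p+q}H_{\mathbf C},\qquad t^{p,q}_H=\dim_{\mathbf C}Gr^q_{\overline F}Gr^p_FH_{\mathbf C}.$$ The $\mathbf R$-splitting level of $H$ is $$\alpha(H)=\frac12\sum_{p,q\in\mathbf Z}(p+q)^2\,(h^{p,q}_H-t^{p,q}_H).$$ *)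

theory Defs
  imports Complex_Main "HOL-Library.Set_Algebras" "HOL-Library.Groups_Big_Fun"
begin

section \<open>Filtrations on subquotients\<close>

text \<open>
  A pair \<open>(A, B)\<close> of subspaces with \<open>B \<subseteq> A\<close> stands for the subquotient \<open>A / B\<close> of the ambient
  space; a subspace of \<open>A / B\<close> is given by its preimage in \<open>A\<close>, which contains \<open>B\<close>.
  A filtration \<open>G\<close> of the ambient space induces on \<open>A / B\<close> the filtration by the images of
  \<open>G p \<inter> A\<close>, whose preimages are \<open>(G p \<inter> A) + B\<close>. By the third isomorphism theorem the graded
  pieces of \<open>A / B\<close> for that filtration are again subquotients of the ambient space.
\<close>

definition induced_filtration ::
    "(int \<Rightarrow> 'v::ab_group_add set) \<Rightarrow> 'v set \<times> 'v set \<Rightarrow> int \<Rightarrow> 'v set" where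
  "induced_filtration G S p = (G p \<inter> fst S) + snd S"

definition graded_piece ::
    "(int \<Rightarrow> 'v::ab_group_add set) \<Rightarrow> int \<Rightarrow> 'v set \<times> 'v set \<Rightarrow> 'v set \<times> 'v set" where
  "graded_piece G p S = (induced_filtration G S p, induced_filtration G S (p + 1))"

section \<open>Complexification of a rational vector space\<close>

text \<open>
  The pair of \<open>scaleC\<close> and \<open>\<iota>\<close> is a model of the scalar extension to \<open>\<complex>\<close> of the rational vector
  space, with \<open>\<iota>\<close> the map \<open>v \<mapsto> v \<otimes> 1\<close>. That the axioms below describe exactly the scalar
  extension is the content of \<open>universal_property\<close>.
\<close>

locale complexification =
  Q: vector_space scaleQ + C: vector_space scaleC
  for scaleQ :: "rat \<Rightarrow> 'a::ab_group_add \<Rightarrow> 'a"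
    and scaleC :: "complex \<Rightarrow> 'b::ab_group_add \<Rightarrow> 'b" +
  fixes \<iota> :: "'a \<Rightarrow> 'b"
  assumes \<iota>_add: "\<iota> (v + w) = \<iota> v + \<iota> w"
    and \<iota>_scale: "\<iota> (scaleQ r v) = scaleC (of_rat r) (\<iota> v)"
    and \<iota>_independent: "Q.independent B \<Longrightarrow> C.independent (\<iota> ` B)"
    and \<iota>_spanning: "C.span (range \<iota>) = UNIV"
begin

text \<open>The real vector space \<open>H\<^sub>\<real>\<close> inside the complexification, as the real span of \<open>H\<^sub>\<rat>\<close>.\<close>

definition real_form :: "'b set" where
  "real_form = module.span (\<lambda>r :: real. scaleC (complex_of_real r)) (range \<iota>)"

definition conjugation :: "'b \<Rightarrow> 'b" where
  "conjugation x = (THE y. \<exists>a\<in>real_form. \<exists>b\<in>real_form.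
     x = a + scaleC \<i> b \<and> y = a - scaleC \<i> b)"

definition conjugate_filtration :: "(int \<Rightarrow> 'b set) \<Rightarrow> int \<Rightarrow> 'b set" where
  "conjugate_filtration G p = conjugation ` G p"

definition weight_filtration_C :: "(int \<Rightarrow> 'a set) \<Rightarrow> int \<Rightarrow> 'b set" where
  "weight_filtration_C W n = C.span (\<iota> ` W n)"

definition subquotient_dim :: "'b set \<times> 'b set \<Rightarrow> int" where
  "subquotient_dim S = int (C.dim (fst S)) - int (C.dim (snd S))"

text \<open>
  The filtration \<open>G\<close> of a subquotient \<open>S = (A, B)\<close> (given by preimages in \<open>A\<close>) is the Hodge
  filtration of a pure Hodge structure of weight \<open>n\<close>: for all \<open>p\<close>, the quotient \<open>A / B\<close> is the
  direct sum of the \<open>p\<close>-th step and the conjugate of the \<open>(n + 1 - p)\<close>-th step.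
\<close>

definition pure_of_weight :: "int \<Rightarrow> 'b set \<times> 'b set \<Rightarrow> (int \<Rightarrow> 'b set) \<Rightarrow> bool" where
  "pure_of_weight n S G \<longleftrightarrow>
     (\<forall>p. G p + conjugation ` G (n + 1 - p) = fst S \<and>
          G p \<inter> conjugation ` G (n + 1 - p) = snd S)"

lemma \<iota>_zero: "\<iota> 0 = 0"
  using \<iota>_add[of 0 0] by simp

lemma \<iota>_inj: "inj \<iota>"
proof (rule injI)
  fix v w assume eq: "\<iota> v = \<iota> w"
  have "\<iota> (v - w) + \<iota> w = \<iota> v"
    by (simp flip: \<iota>_add)
  hence "\<iota> (v - w) = 0"
    using eq by simp
  hence "C.dependent (\<iota> ` {v - w})"
    by (simp add: C.dependent_zero)
  hence "Q.dependent {v - w}"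
    using \<iota>_independent by blast
  thus "v = w"
    by simp
qed

lemma \<iota>_in_span:
  assumes "v \<in> Q.span B" shows "\<iota> v \<in> C.span (\<iota> ` B)"
  using assms
proof (induction rule: Q.span_induct_alt)
  case base
  show ?case by (simp add: \<iota>_zero C.span_zero)
next
  case (step c x y)
  thus ?case
    by (simp add: \<iota>_add \<iota>_scale C.span_add C.span_scale C.span_base)
qed

lemma span_\<iota>_basis:
  assumes "Q.span B = UNIV" shows "C.span (\<iota> ` B) = UNIV"
proof -
  have "range \<iota> \<subseteq> C.span (\<iota> ` B)"
    using \<iota>_in_span assms by blast
  hence "C.span (range \<iota>) \<subseteq> C.span (\<iota> ` B)"
    by (simp add: C.span_minimal)
  thus ?thesis using \<iota>_spanning by auto
qed

theorem universal_property:
  fixes scale' :: "complex \<Rightarrow> 'c::ab_group_add \<Rightarrow> 'c" and f :: "'a \<Rightarrow> 'c"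
  assumes "vector_space scale'"
    and f_add: "\<And>v w. f (v + w) = f v + f w"
    and f_scale: "\<And>r v. f (scaleQ r v) = scale' (of_rat r) (f v)"
  shows "\<exists>!g. Vector_Spaces.linear scaleC scale' g \<and> (\<forall>v. g (\<iota> v) = f v)"
proof -
  interpret C': vector_space scale' by fact
  interpret P: vector_space_pair scaleC scale' ..
  obtain B where B: "Q.independent B" "Q.span B = UNIV"
    using Q.maximal_independent_subset[of UNIV] top.extremum_uniqueI by metis
  define g where "g = P.construct (\<iota> ` B) (\<lambda>x. f (inv \<iota> x))"
  have lin: "Vector_Spaces.linear scaleC scale' g"
    unfolding g_def by (intro P.linear_construct \<iota>_independent B)
  then interpret g: Vector_Spaces.linear scaleC scale' g .
  have basis: "g (\<iota> b) = f b" if "b \<in> B" for b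
    unfolding g_def
    by (subst P.construct_basis) (use that \<iota>_inj \<iota>_independent B in auto)
  have f0: "f 0 = 0" using f_add[of 0 0] by simp
  have ext: "g (\<iota> v) = f v" for v
  proof -
    have "v \<in> Q.span B" using B by simp
    thus ?thesis
      by (induction rule: Q.span_induct_alt)
         (simp_all add: \<iota>_zero f0 \<iota>_add \<iota>_scale f_add f_scale g.add g.scale basis)
  qed
  show ?thesis
  proof (rule ex1I[of _ g])
    fix h assume h: "Vector_Spaces.linear scaleC scale' h \<and> (\<forall>v. h (\<iota> v) = f v)"
    show "h = g"
    proof
      fix x
      show "h x = g x"
        by (rule P.linear_eq_on[of h g _ "range \<iota>"]) (use h lin ext \<iota>_spanning in auto)
    qed
  qed (use lin ext in auto)
qed

text \<open>The description operator in \<open>conjugation\<close> is well defined, and yields the antilinear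
  involution fixing the rational structure.\<close>

lemma real_module: "vector_space (\<lambda>r :: real. scaleC (complex_of_real r))"
  by unfold_locales (simp_all add: C.scale_right_distrib C.scale_left_distrib)

lemma real_form_decomposition: "\<exists>a\<in>real_form. \<exists>b\<in>real_form. x = a + scaleC \<i> b"
proof -
  interpret R: vector_space "\<lambda>r :: real. scaleC (complex_of_real r)" by (rule real_module)
  have "x \<in> C.span (range \<iota>)" using \<iota>_spanning by simp
  thus ?thesis
  proof (induction rule: C.span_induct_alt)
    case base
    show ?case
      by (intro bexI[of _ 0]) (auto simp: real_form_def R.span_zero)
  next
    case (step c x y)
    then obtain a b where ab: "a \<in> real_form" "b \<in> real_form" "y = a + scaleC \<i> b" by blast
    let ?a = "scaleC (complex_of_real (Re c)) x + a"
    let ?b = "scaleC (complex_of_real (Im c)) x + b"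
    have "?a \<in> real_form" "?b \<in> real_form"
      using ab R.span_base[OF step(1)] unfolding real_form_def
      by (intro R.span_add R.span_scale; simp)+
    moreover have "scaleC c x = scaleC (complex_of_real (Re c)) x + scaleC (\<i> * complex_of_real (Im c)) x"
      by (subst C.scale_left_distrib[symmetric]) (simp flip: complex_eq)
    hence "scaleC c x + y = ?a + scaleC \<i> ?b"
      by (simp add: ab algebra_simps)
    ultimately show ?case by blast
  qed
qed

lemma real_form_complement:
  assumes "a \<in> real_form" "b \<in> real_form" "a + scaleC \<i> b = 0"
  shows "a = 0 \<and> b = 0"
proof -
  interpret R: vector_space "\<lambda>r :: real. scaleC (complex_of_real r)" by (rule real_module)
  obtain B where B: "Q.independent B" "Q.span B = UNIV"
    using Q.maximal_independent_subset[of UNIV] top.extremum_uniqueI by metis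
  let ?B = "\<iota> ` B" and ?rep = "C.representation (\<iota> ` B)"
  have ind: "C.independent ?B" and sp: "C.span ?B = UNIV"
    using B \<iota>_independent span_\<iota>_basis by auto
  have rat_rep: "Im (?rep (\<iota> v) b) = 0" for v b
  proof -
    have "v \<in> Q.span B" using B by simp
    thus ?thesis
    proof (induction rule: Q.span_induct_alt)
      case base
      show ?case by (simp add: \<iota>_zero C.representation_zero)
    next
      case (step c x y)
      have "?rep (\<iota> x) b = (if b = \<iota> x then 1 else 0)"
        using C.representation_basis[OF ind, of "\<iota> x"] step by auto
      moreover have "of_rat c = complex_of_real (of_rat c)"
        by (induction c)
           (simp add: of_rat_rat)
      ultimately show ?case
        using step
        by (simp add: \<iota>_add \<iota>_scale C.representation_add[OF ind] C.representation_scale[OF ind] sp)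
    qed
  qed
  have real_rep: "Im (?rep x b) = 0" if "x \<in> real_form" for x b
    using that unfolding real_form_def
    by (induction rule: R.span_induct_alt)
       (auto simp: C.representation_zero C.representation_add[OF ind]
          C.representation_scale[OF ind] sp rat_rep)
  have rep_eq: "?rep a c + \<i> * ?rep b c = 0" for c
    using arg_cong[OF assms(3), of "\<lambda>x. ?rep x c"]
    by (simp add: C.representation_add[OF ind] C.representation_scale[OF ind] sp C.representation_zero)
  have "?rep a c = 0 \<and> ?rep b c = 0" for c
    using rep_eq[of c] real_rep[OF assms(1), of c] real_rep[OF assms(2), of c]
    by (simp add: complex_eq_iff)
  hence "(\<Sum>c | ?rep a c \<noteq> 0. scaleC (?rep a c) c) = 0" "(\<Sum>c | ?rep b c \<noteq> 0. scaleC (?rep b c) c) = 0"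
    by simp_all
  thus ?thesis
    using C.sum_nonzero_representation_eq[OF ind] sp by simp
qed

lemma conjugation_eq:
  assumes "a \<in> real_form" "b \<in> real_form"
  shows "conjugation (a + scaleC \<i> b) = a - scaleC \<i> b"
  unfolding conjugation_def
proof (rule the_equality)
  interpret R: vector_space "\<lambda>r :: real. scaleC (complex_of_real r)" by (rule real_module)
  fix y
  assume "\<exists>a'\<in>real_form. \<exists>b'\<in>real_form.
    a + scaleC \<i> b = a' + scaleC \<i> b' \<and> y = a' - scaleC \<i> b'"
  then obtain a' b' where *: "a' \<in> real_form" "b' \<in> real_form"
    "a + scaleC \<i> b = a' + scaleC \<i> b'" "y = a' - scaleC \<i> b'" by blast
  have "(a - a') + scaleC \<i> (b - b') = 0"
    using *(3) by (simp add: algebra_simps)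
  moreover have "a - a' \<in> real_form" "b - b' \<in> real_form"
    using assms * unfolding real_form_def by (auto intro: R.span_diff)
  ultimately have "a = a'" "b = b'"
    using real_form_complement by fastforce+
  thus "y = a - scaleC \<i> b" using * by simp
qed (use assms in blast)

lemma conjugation_\<iota>: "conjugation (\<iota> v) = \<iota> v"
proof -
  interpret R: vector_space "\<lambda>r :: real. scaleC (complex_of_real r)" by (rule real_module)
  show ?thesis
    using conjugation_eq[of "\<iota> v" 0] by (simp add: real_form_def R.span_base R.span_zero)
qed

lemma conjugation_add: "conjugation (x + y) = conjugation x + conjugation y"
proof -
  interpret R: vector_space "\<lambda>r :: real. scaleC (complex_of_real r)" by (rule real_module)
  obtain a b where x: "a \<in> real_form" "b \<in> real_form" "x = a + scaleC \<i> b"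
    using real_form_decomposition by blast
  obtain c d where y: "c \<in> real_form" "d \<in> real_form" "y = c + scaleC \<i> d"
    using real_form_decomposition by blast
  have "a + c \<in> real_form" "b + d \<in> real_form"
    using x y unfolding real_form_def by (auto intro: R.span_add)
  hence "conjugation ((a + c) + scaleC \<i> (b + d)) = (a + c) - scaleC \<i> (b + d)"
    by (rule conjugation_eq)
  moreover have "(a + c) + scaleC \<i> (b + d) = x + y"
    by (simp add: x y algebra_simps)
  ultimately show ?thesis
    by (simp add: x y conjugation_eq algebra_simps)
qed

lemma conjugation_scale: "conjugation (scaleC z x) = scaleC (cnj z) (conjugation x)"
proof -
  interpret R: vector_space "\<lambda>r :: real. scaleC (complex_of_real r)" by (rule real_module)
  obtain a b where x: "a \<in> real_form" "b \<in> real_form" "x = a + scaleC \<i> b"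
    using real_form_decomposition by blast
  let ?s = "\<lambda>r. scaleC (complex_of_real r)"
  let ?a = "?s (Re z) a - ?s (Im z) b" and ?b = "?s (Im z) a + ?s (Re z) b"
  have mem: "?a \<in> real_form" "?b \<in> real_form"
    using x unfolding real_form_def
    by (auto intro!: R.span_add R.span_diff R.span_scale[of a] R.span_scale[of b])
  have z: "scaleC z v = ?s (Re z) v + scaleC \<i> (?s (Im z) v)"
    "scaleC (cnj z) v = ?s (Re z) v - scaleC \<i> (?s (Im z) v)" for v
    by (simp_all flip: C.scale_left_distrib C.scale_left_diff_distrib)
       (simp_all flip: complex_eq add: complex_eq_iff)
  have i: "?s r (scaleC \<i> v) = scaleC \<i> (?s r v)" "scaleC \<i> (scaleC \<i> v) = - v" for r v
    by (simp_all add: mult.commute)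
  have "scaleC z x = ?a + scaleC \<i> ?b"
    unfolding x z by (simp only: C.scale_right_distrib i) (simp add: algebra_simps)
  hence "conjugation (scaleC z x) = ?a - scaleC \<i> ?b"
    using conjugation_eq[OF mem] by simp
  also have "\<dots> = scaleC (cnj z) (a - scaleC \<i> b)"
    unfolding z by (simp only: C.scale_right_distrib C.scale_right_diff_distrib i) (simp add: algebra_simps)
  finally show ?thesis using x conjugation_eq by simp
qed

end

section \<open>Mixed Hodge structures\<close>

locale mixed_Hodge_structure = complexification scaleQ scaleC \<iota>
  for scaleQ :: "rat \<Rightarrow> 'a::ab_group_add \<Rightarrow> 'a"
    and scaleC :: "complex \<Rightarrow> 'b::ab_group_add \<Rightarrow> 'b"
    and \<iota> :: "'a \<Rightarrow> 'b" +
  fixes W :: "int \<Rightarrow> 'a set"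
    and F :: "int \<Rightarrow> 'b set"
  assumes finite_dimensional: "\<exists>B. finite B \<and> Q.span B = UNIV"
    and W_subspace: "Q.subspace (W n)"
    and W_increasing: "m \<le> n \<Longrightarrow> W m \<subseteq> W n"
    and W_separated: "\<exists>n. W n = {0}"
    and W_exhaustive: "\<exists>n. W n = UNIV"
    and F_subspace: "C.subspace (F p)"
    and F_decreasing: "p \<le> q \<Longrightarrow> F q \<subseteq> F p"
    and F_separated: "\<exists>p. F p = {0}"
    and F_exhaustive: "\<exists>p. F p = UNIV"
    and Gr_W_pure:
      "pure_of_weight n (weight_filtration_C W n, weight_filtration_C W (n - 1))
         (induced_filtration F (weight_filtration_C W n, weight_filtration_C W (n - 1)))"
begin

definition hodge_number :: "int \<Rightarrow> int \<Rightarrow> int" where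
  "hodge_number p q = subquotient_dim
     (graded_piece (conjugate_filtration F) q
       (graded_piece F p
         (weight_filtration_C W (p + q), weight_filtration_C W (p + q - 1))))"

definition total_number :: "int \<Rightarrow> int \<Rightarrow> int" where
  "total_number p q = subquotient_dim
     (graded_piece (conjugate_filtration F) q (graded_piece F p (UNIV, {0})))"

text \<open>Only finitely many terms are nonzero, see \<open>finite_support\<close>.\<close>

definition R_splitting_level :: real where
  "R_splitting_level =
     1 / 2 * Sum_any (\<lambda>(p, q). real_of_int ((p + q)\<^sup>2 * (hodge_number p q - total_number p q)))"

lemma finite_nontrivial_steps:
  shows "finite {p. F p \<noteq> F (p + 1)}"
    and "finite {q. conjugate_filtration F q \<noteq> conjugate_filtration F (q + 1)}"
proof -
  obtain a b where ab: "F a = UNIV" "F b = {0}"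
    using F_separated F_exhaustive by blast
  have "F p = F (p + 1)" if "p \<notin> {a..b}" for p
  proof (cases "p < a")
    case True
    hence "F a \<subseteq> F p" "F a \<subseteq> F (p + 1)" by (simp_all add: F_decreasing)
    thus ?thesis using ab by auto
  next
    case False
    hence "F p \<subseteq> F b" "F (p + 1) \<subseteq> F b" using that by (simp_all add: F_decreasing)
    moreover have "0 \<in> F p" "0 \<in> F (p + 1)" using F_subspace C.subspace_0 by blast+
    ultimately show ?thesis using ab by auto
  qed
  hence "{p. F p \<noteq> F (p + 1)} \<subseteq> {a..b}" by blast
  hence *: "finite {p. F p \<noteq> F (p + 1)}" by (rule finite_subset) simp
  thus "finite {p. F p \<noteq> F (p + 1)}" by simp
  show "finite {q. conjugate_filtration F q \<noteq> conjugate_filtration F (q + 1)}"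
    by (rule finite_subset[OF _ *]) (auto simp: conjugate_filtration_def)
qed

lemma finite_support: "finite {(p, q). hodge_number p q \<noteq> 0 \<or> total_number p q \<noteq> 0}"
proof -
  let ?F = "conjugate_filtration F"
  have dim0: "subquotient_dim (graded_piece G q S) = 0" if "G q = G (q + 1)" for G q S
    using that by (simp add: subquotient_dim_def graded_piece_def induced_filtration_def)
  have dim0': "subquotient_dim (graded_piece G q (A, A)) = 0"
    if "0 \<in> A" "A + A = A" "\<forall>q. 0 \<in> G q" for G q A
  proof -
    have "(G q \<inter> A) + A = A" for q
    proof
      have "G q \<inter> A \<subseteq> A" by blast
      hence "(G q \<inter> A) + A \<subseteq> A + A" by (intro set_plus_mono2) auto
      thus "(G q \<inter> A) + A \<subseteq> A" using that by simp
      show "A \<subseteq> (G q \<inter> A) + A" using that by (intro set_zero_plus2) auto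
    qed
    thus ?thesis
      by (simp add: subquotient_dim_def graded_piece_def induced_filtration_def)
  qed
  have sub: "C.subspace (A + B)" if "C.subspace A" "C.subspace B" for A B
  proof -
    have "A + B = {x + y | x y. x \<in> A \<and> y \<in> B}" by (auto simp: set_plus_def)
    thus ?thesis using C.subspace_sums[OF that] by simp
  qed
  have add_self: "A + A = A" "0 \<in> A" if "C.subspace A" for A
  proof -
    show 0: "0 \<in> A" using that by (rule C.subspace_0)
    show "A + A = A"
      using that 0 set_zero_plus2[of A A] by (auto simp: set_plus_def C.subspace_add)
  qed
  have F0: "\<forall>q. 0 \<in> ?F q"
  proof
    fix q
    have "conjugation 0 = 0" using conjugation_add[of 0 0] by simp
    thus "0 \<in> ?F q"
      unfolding conjugate_filtration_def using F_subspace[of q] C.subspace_0 by (metis imageI)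
  qed
  have gr: "subquotient_dim (graded_piece ?F q (graded_piece F p (A, B))) = 0"
    if "F p = F (p + 1) \<or> ?F q = ?F (q + 1)" "C.subspace A" "C.subspace B" for p q A B
    using that(1)
  proof
    assume eq: "F p = F (p + 1)"
    let ?A = "(F p \<inter> A) + B"
    have "C.subspace ?A"
      using that F_subspace by (intro sub C.subspace_inter)
    thus ?thesis
      using dim0'[of ?A ?F q] add_self F0 eq by (simp add: graded_piece_def[of F] induced_filtration_def[of F])
  qed (use dim0 in blast)
  have "{(p, q). hodge_number p q \<noteq> 0 \<or> total_number p q \<noteq> 0}
      \<subseteq> {p. F p \<noteq> F (p + 1)} \<times> {q. ?F q \<noteq> ?F (q + 1)}"
    unfolding hodge_number_def total_number_def
    by (auto simp: weight_filtration_C_def gr)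
  thus ?thesis
    by (rule finite_subset) (use finite_nontrivial_steps in simp)
qed

end

end

theory Submission
  imports Defs
begin

text \<open>
  Write \<open>e p q\<close> for the dimension of \<open>F\<^sup>p \<inter> G\<^sup>q\<close>, where \<open>G\<close> is the conjugate of \<open>F\<close>, and
  \<open>E p q\<close> for the sum over \<open>n\<close> of the dimensions of the intersections of the filtrations induced
  by \<open>F\<close> and \<open>G\<close> on the graded pieces of \<open>W\<close>. The numbers \<open>t p q\<close> are the mixed second
  differences of \<open>e\<close>, and purity makes the numbers \<open>h p q\<close> those of \<open>E\<close>. The defect \<open>E - e\<close> is
  nonnegative, because the graded piece of \<open>F\<^sup>p \<inter> G\<^sup>q\<close> lies in the intersection of the induced
  steps, and it has finite support, because a single filtration is additive on the graded pieces.
  Summation by parts against \<open>(p + q)\<^sup>2\<close>, whose mixed second difference is the constant 2,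
  turns the splitting level into the sum of all defects.
\<close>

section \<open>Summation\<close>

lemma sum_telescope_int:
  fixes f :: "int \<Rightarrow> 'a::ab_group_add"
  assumes "a \<le> b"
  shows "(\<Sum>n\<in>{a<..b}. f n - f (n - 1)) = f b - f a"
  using assms
proof (induction b rule: int_ge_induct)
  case (step i)
  have "{a<..i + 1} = insert (i + 1) {a<..i}"
    using step.hyps by auto
  thus ?case
    using step.IH by simp
qed simp

lemma finite_support_shift:
  fixes D :: "int \<Rightarrow> int \<Rightarrow> real" and c :: "int \<Rightarrow> int \<Rightarrow> real"
  assumes "finite {x. case_prod D x \<noteq> 0}"
  shows "finite {x. (case x of (p, q) \<Rightarrow> c p q * D (p + i) (q + j)) \<noteq> 0}"
proof (rule finite_subset)
  show "{x. (case x of (p, q) \<Rightarrow> c p q * D (p + i) (q + j)) \<noteq> 0}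
      \<subseteq> (\<lambda>(p, q). (p - i, q - j)) ` {x. case_prod D x \<noteq> 0}"
  proof
    fix x assume "x \<in> {x. (case x of (p, q) \<Rightarrow> c p q * D (p + i) (q + j)) \<noteq> 0}"
    then show "x \<in> (\<lambda>(p, q). (p - i, q - j)) ` {x. case_prod D x \<noteq> 0}"
      by (intro image_eqI[of _ _ "(fst x + i, snd x + j)"]) (auto split: prod.splits)
  qed
qed (use assms in simp)

lemma Sum_any_shift:
  fixes D :: "int \<Rightarrow> int \<Rightarrow> real" and c :: "int \<Rightarrow> int \<Rightarrow> real"
  shows "Sum_any (\<lambda>(p, q). c p q * D (p + i) (q + j)) =
    Sum_any (\<lambda>(p, q). c (p - i) (q - j) * D p q)"
proof (rule sym, rule Sum_any.reindex_cong)
  show "bij (\<lambda>(p, q). (p + i, q + j) :: int \<times> int)"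
    by (rule bij_betw_byWitness[where f' = "\<lambda>(p, q). (p - i, q - j)"]) auto
qed (auto simp: fun_eq_iff)

text \<open>Summation by parts: moving the shifts from \<open>D\<close> to the weight replaces the
  weight by s^2 - 2 (s - 1)^2 + (s - 2)^2 = 2, where s = p + q. Finite support rules out boundary
  terms.\<close>

lemma Sum_any_square_mixed_difference:
  fixes D :: "int \<Rightarrow> int \<Rightarrow> real"
  assumes fin: "finite {x. case_prod D x \<noteq> 0}"
  shows "Sum_any (\<lambda>(p, q). (real_of_int (p + q))\<^sup>2 *
      (D p q - D (p + 1) q - D p (q + 1) + D (p + 1) (q + 1))) =
    2 * Sum_any (\<lambda>(p, q). D p q)"
proof -
  define c :: "int \<Rightarrow> int \<Rightarrow> real" where "c p q = (real_of_int (p + q))\<^sup>2" for p q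
  define T where "T i j = (\<lambda>(p, q). c p q * D (p + i) (q + j))" for i j
  define U where "U i j = (\<lambda>(p, q). c (p - i) (q - j) * D p q)" for i j
  have finT: "finite {x. T i j x \<noteq> 0}" for i j
    unfolding T_def by (rule finite_support_shift[OF fin])
  have finU: "finite {x. U i j x \<noteq> 0}" for i j
    unfolding U_def
    using finite_support_shift[OF fin, of "\<lambda>p q. c (p - i) (q - j)" 0 0] by simp
  \<comment> \<open>Additivity of \<open>Sum_any\<close> needs finite supports, and
    \<open>Sum_any.distrib\<close> covers sums only, so the subtracted part is added back.\<close>
  have lin: "Sum_any (\<lambda>x. f x + g x - (h x + k x)) = Sum_any f + Sum_any g - (Sum_any h + Sum_any k)"
    if "finite {x. f x \<noteq> 0}" "finite {x. g x \<noteq> 0}" "finite {x. h x \<noteq> 0}" "finite {x. k x \<noteq> 0}"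
    for f g h k :: "int \<times> int \<Rightarrow> real"
  proof -
    let ?d = "\<lambda>x. f x + g x - (h x + k x)"
    have fin': "finite {x. ?d x \<noteq> 0}" "finite {x. h x + k x \<noteq> 0}"
      by (rule finite_subset[of _ "{x. f x \<noteq> 0} \<union> {x. g x \<noteq> 0} \<union> {x. h x \<noteq> 0} \<union> {x. k x \<noteq> 0}"],
          use that in auto)+
    have "Sum_any (\<lambda>x. ?d x + (h x + k x)) = Sum_any ?d + (Sum_any h + Sum_any k)"
      using Sum_any.distrib[OF fin'] Sum_any.distrib[OF that(3,4)] by simp
    moreover have "Sum_any (\<lambda>x. ?d x + (h x + k x)) = Sum_any f + Sum_any g"
      using Sum_any.distrib[OF that(1,2)] by simp
    ultimately show ?thesis by simp
  qed
  have "Sum_any (\<lambda>(p, q). (real_of_int (p + q))\<^sup>2 *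
      (D p q - D (p + 1) q - D p (q + 1) + D (p + 1) (q + 1))) =
    Sum_any (\<lambda>x. T 0 0 x + T 1 1 x - (T 1 0 x + T 0 1 x))"
    by (intro Sum_any.cong) (auto simp: T_def c_def algebra_simps)
  also have "\<dots> = Sum_any (T 0 0) + Sum_any (T 1 1) - (Sum_any (T 1 0) + Sum_any (T 0 1))"
    by (intro lin finT)
  also have "\<dots> = Sum_any (U 0 0) + Sum_any (U 1 1) - (Sum_any (U 1 0) + Sum_any (U 0 1))"
    unfolding T_def U_def by (simp only: Sum_any_shift)
  also have "\<dots> = Sum_any (\<lambda>x. U 0 0 x + U 1 1 x - (U 1 0 x + U 0 1 x))"
    by (intro lin[symmetric] finU)
  also have "\<dots> = Sum_any (\<lambda>x. 2 * case_prod D x)"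
    by (intro Sum_any.cong) (auto simp: U_def c_def power2_eq_square algebra_simps)
  also have "\<dots> = 2 * Sum_any (case_prod D)"
    by (rule Sum_any_right_distrib[symmetric]) (rule fin)
  finally show ?thesis by simp
qed

section \<open>Two filtrations on a subquotient\<close>

lemma induced_filtration_mono:
  "F p \<subseteq> F' p' \<Longrightarrow> induced_filtration F S p \<subseteq> induced_filtration F' S p'"
  unfolding induced_filtration_def by (intro set_plus_mono2) auto

context vector_space
begin

lemma subspace_plus:
  assumes "subspace A" "subspace B" shows "subspace (A + B)"
proof -
  have "A + B = {x + y | x y. x \<in> A \<and> y \<in> B}" by (auto simp: set_plus_def)
  thus ?thesis using subspace_sums[OF assms] by simp
qed

lemma plus_subset_subspace:
  "subspace C \<Longrightarrow> A \<subseteq> C \<Longrightarrow> B \<subseteq> C \<Longrightarrow> A + B \<subseteq> C"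
  by (auto simp: set_plus_def intro!: subspace_add)

lemma subspace_induced_filtration:
  "subspace (F p) \<Longrightarrow> subspace A \<Longrightarrow> subspace B \<Longrightarrow> subspace (induced_filtration F (A, B) p)"
  by (simp add: induced_filtration_def subspace_plus subspace_inter)

lemma snd_subset_induced_filtration:
  "subspace (F p) \<Longrightarrow> subspace A \<Longrightarrow> B \<subseteq> induced_filtration F (A, B) p"
  unfolding induced_filtration_def
  by (simp add: set_zero_plus2 subspace_0)

lemma induced_filtration_subset_fst:
  "subspace A \<Longrightarrow> B \<subseteq> A \<Longrightarrow> induced_filtration F (A, B) p \<subseteq> A"
  by (simp add: induced_filtration_def plus_subset_subspace)

text \<open>For subspaces with \<open>snd S \<subseteq> fst S\<close>, both preimages contain
  \<open>snd S\<close>, so this is the dimension of the intersection of the two induced steps inside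
  the subquotient.\<close>

definition bifiltered_dim ::
    "(int \<Rightarrow> 'b set) \<Rightarrow> (int \<Rightarrow> 'b set) \<Rightarrow> 'b set \<times> 'b set \<Rightarrow> int \<Rightarrow> int \<Rightarrow> int" where
  "bifiltered_dim F G S p q =
     int (dim (induced_filtration F S p \<inter> induced_filtration G S q)) - int (dim (snd S))"

text \<open>The common shape of \<open>hodge_number\<close> and \<open>total_number\<close>, with an
  arbitrary \<open>G\<close> in place of the conjugate filtration.\<close>

definition bigraded_dim ::
    "(int \<Rightarrow> 'b set) \<Rightarrow> (int \<Rightarrow> 'b set) \<Rightarrow> 'b set \<times> 'b set \<Rightarrow> int \<Rightarrow> int \<Rightarrow> int" where
  "bigraded_dim F G S p q =
     int (dim (fst (graded_piece G q (graded_piece F p S)))) -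
     int (dim (snd (graded_piece G q (graded_piece F p S))))"

end

definition mixed_difference :: "(int \<Rightarrow> int \<Rightarrow> 'a::ab_group_add) \<Rightarrow> int \<Rightarrow> int \<Rightarrow> 'a" where
  "mixed_difference f p q = f p q - f (p + 1) q - f p (q + 1) + f (p + 1) (q + 1)"

context finite_dimensional_vector_space
begin

lemma bifiltered_dim_commute: "bifiltered_dim F G S p q = bifiltered_dim G F S q p"
  by (simp add: bifiltered_dim_def Int_commute)

lemma dim_plus_eq:
  assumes "subspace A" "subspace B"
  shows "int (dim (A + B)) = int (dim A) + int (dim B) - int (dim (A \<inter> B))"
proof -
  have "A + B = {x + y | x y. x \<in> A \<and> y \<in> B}" by (auto simp: set_plus_def)
  thus ?thesis using dim_sums_Int[OF assms] by simp
qed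

text \<open>By the modular law, \<open>B \<subseteq> X \<subseteq> A\<close> turns the intersection
  into \<open>(G q \<inter> X) + B\<close>; the dimension formula for a sum does the rest.\<close>

lemma dim_induced_Int:
  assumes "subspace A" "subspace B" "subspace (G q)" "subspace X" "B \<subseteq> X" "X \<subseteq> A"
  shows "int (dim (X \<inter> induced_filtration G (A, B) q)) - int (dim B) =
    int (dim (G q \<inter> X)) - int (dim (G q \<inter> B))"
proof -
  have "X \<inter> induced_filtration G (A, B) q = (G q \<inter> X) + B"
  proof
    show "X \<inter> induced_filtration G (A, B) q \<subseteq> (G q \<inter> X) + B"
    proof
      fix x assume x: "x \<in> X \<inter> induced_filtration G (A, B) q"
      then obtain y z where yz: "x = y + z" "y \<in> G q" "y \<in> A" "z \<in> B"
        by (auto simp: induced_filtration_def set_plus_def)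
      have "y = x - z" using yz by simp
      hence "y \<in> X" using x yz assms subspace_diff[of X x z] by auto
      thus "x \<in> (G q \<inter> X) + B" using yz by auto
    qed
    show "(G q \<inter> X) + B \<subseteq> X \<inter> induced_filtration G (A, B) q"
      using assms plus_subset_subspace[of X "G q \<inter> X" B]
      by (auto simp: induced_filtration_def set_plus_def)
  qed
  moreover have "G q \<inter> X \<inter> B = G q \<inter> B" using assms by auto
  ultimately show ?thesis
    using dim_plus_eq[of "G q \<inter> X" B] assms by (simp add: subspace_inter)
qed

text \<open>The dimensions of \<open>?X (p + 1)\<close> cancel between the steps \<open>q\<close>
  and \<open>q + 1\<close>. The terms by which \<open>d\<close> differs from
  \<open>bifiltered_dim\<close> depend on \<open>q\<close> alone, so they drop out of the mixed
  difference.\<close>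

lemma bigraded_dim_eq_mixed_difference:
  assumes A: "subspace A" and B: "subspace B" and BA: "B \<subseteq> A"
    and F: "\<And>p. subspace (F p)" "\<And>p. F (p + 1) \<subseteq> F p"
    and G: "\<And>q. subspace (G q)"
  shows "bigraded_dim F G (A, B) p q = mixed_difference (bifiltered_dim F G (A, B)) p q"
proof -
  let ?X = "induced_filtration F (A, B)"
  define d where "d p q = int (dim (G q \<inter> ?X p))" for p q
  have X: "subspace (?X p)" "B \<subseteq> ?X p" "?X p \<subseteq> A" "?X (p + 1) \<subseteq> ?X p" for p
    using A B BA F
    by (simp_all add: subspace_induced_filtration snd_subset_induced_filtration
        induced_filtration_subset_fst induced_filtration_mono)
  have piece: "int (dim ((G q \<inter> ?X p) + ?X (p + 1))) = d p q + int (dim (?X (p + 1))) - d (p + 1) q"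
    for p q
  proof -
    have "G q \<inter> ?X p \<inter> ?X (p + 1) = G q \<inter> ?X (p + 1)" using X by blast
    thus ?thesis
      using dim_plus_eq[of "G q \<inter> ?X p" "?X (p + 1)"] X(1) G by (simp add: d_def subspace_inter)
  qed
  have "bifiltered_dim F G (A, B) p q = d p q - int (dim (G q \<inter> B))" for p q
    using dim_induced_Int[OF A B, of G q "?X p"] X G by (simp add: bifiltered_dim_def d_def)
  moreover have "bigraded_dim F G (A, B) p q = (d p q - d (p + 1) q) - (d p (q + 1) - d (p + 1) (q + 1))"
    by (simp add: bigraded_dim_def graded_piece_def induced_filtration_def[of G] piece)
  ultimately show ?thesis by (simp add: mixed_difference_def)
qed

end

section \<open>Three opposed filtrations\<close>

text \<open>Purity without conjugation: on the n-th graded piece of \<open>W\<close>, the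
  filtrations \<open>F\<close> and \<open>G\<close> are n-opposed. With \<open>G\<close> arbitrary
  the axioms are symmetric in \<open>F\<close> and \<open>G\<close>, so facts about \<open>F\<close>
  transfer to \<open>G\<close> by swapping. Common bounds \<open>lo\<close> and \<open>hi\<close>
  keep all sums over weights finite.\<close>

locale opposed_filtrations = finite_dimensional_vector_space +
  fixes W F G :: "int \<Rightarrow> 'b set" and lo hi :: int
  assumes W_subspace: "subspace (W n)" and F_subspace: "subspace (F p)" and G_subspace: "subspace (G p)"
    and W_increasing: "m \<le> n \<Longrightarrow> W m \<subseteq> W n"
    and F_decreasing: "p \<le> q \<Longrightarrow> F q \<subseteq> F p"
    and G_decreasing: "p \<le> q \<Longrightarrow> G q \<subseteq> G p"
    and lo_le_hi: "lo \<le> hi"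
    and W_bounds: "W lo = {0}" "W hi = UNIV"
    and F_bounds: "F lo = UNIV" "F hi = {0}"
    and G_bounds: "G lo = UNIV" "G hi = {0}"
    and opposed_plus: "p + q = n + 1 \<Longrightarrow>
      induced_filtration F (W n, W (n - 1)) p + induced_filtration G (W n, W (n - 1)) q = W n"
    and opposed_Int: "p + q = n + 1 \<Longrightarrow>
      induced_filtration F (W n, W (n - 1)) p \<inter> induced_filtration G (W n, W (n - 1)) q = W (n - 1)"
begin

lemma opposed_filtrations_swap: "opposed_filtrations scale Basis W G F lo hi"
  using W_increasing F_decreasing G_decreasing lo_le_hi opposed_plus opposed_Int
  by unfold_locales
    (auto simp: W_subspace F_subspace G_subspace W_bounds F_bounds G_bounds add.commute Int_commute)

section \<open>Dimensions on the graded pieces of \<open>W\<close>\<close>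

abbreviation Gr :: "int \<Rightarrow> 'b set \<times> 'b set" where
  "Gr n \<equiv> (W n, W (n - 1))"

abbreviation gr_dim :: "int \<Rightarrow> int \<Rightarrow> int \<Rightarrow> int" where
  "gr_dim n \<equiv> bifiltered_dim F G (Gr n)"

lemma W_step: "W (n - 1) \<subseteq> W n"
  by (simp add: W_increasing)

lemma induced_F:
  "subspace (induced_filtration F (Gr n) p)" "W (n - 1) \<subseteq> induced_filtration F (Gr n) p"
  "induced_filtration F (Gr n) p \<subseteq> W n"
  by (simp_all add: W_subspace F_subspace W_step subspace_induced_filtration
      snd_subset_induced_filtration induced_filtration_subset_fst)

lemmas induced_G = opposed_filtrations.induced_F[OF opposed_filtrations_swap]

text \<open>Here \<open>F p\<close> lies in \<open>F (n + 1 - q)\<close>, whose induced step already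
  meets that of \<open>G q\<close> only in \<open>W (n - 1)\<close>, the zero of the graded
  piece.\<close>

lemma gr_dim_above:
  assumes "p + q \<ge> n + 1" shows "gr_dim n p q = 0"
proof -
  have "induced_filtration F (Gr n) p \<subseteq> induced_filtration F (Gr n) (n + 1 - q)"
    using assms by (intro induced_filtration_mono F_decreasing) simp
  hence "induced_filtration F (Gr n) p \<inter> induced_filtration G (Gr n) q = W (n - 1)"
    using opposed_Int[of "n + 1 - q" q n] induced_F(2)[of n p] induced_G(2)[of n q] by auto
  thus ?thesis by (simp add: bifiltered_dim_def)
qed

text \<open>Here the two induced steps together span the graded piece, so the dimension formula
  gives a term in \<open>p\<close> plus a term in \<open>q\<close> plus a constant, and such a
  function has zero mixed difference.\<close>

lemma gr_dim_below:
  assumes "p + q \<le> n + 1"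
  shows "gr_dim n p q = int (dim (induced_filtration F (Gr n) p)) +
    int (dim (induced_filtration G (Gr n) q)) - int (dim (W n)) - int (dim (W (n - 1)))"
proof -
  have "induced_filtration F (Gr n) (n + 1 - q) \<subseteq> induced_filtration F (Gr n) p"
    using assms by (intro induced_filtration_mono F_decreasing) simp
  hence "induced_filtration F (Gr n) (n + 1 - q) + induced_filtration G (Gr n) q
      \<subseteq> induced_filtration F (Gr n) p + induced_filtration G (Gr n) q"
    by (rule set_plus_mono2[OF _ order_refl])
  moreover have "induced_filtration F (Gr n) (n + 1 - q) + induced_filtration G (Gr n) q = W n"
    by (rule opposed_plus) simp
  ultimately have "W n \<subseteq> induced_filtration F (Gr n) p + induced_filtration G (Gr n) q"
    by (simp only:)
  hence "induced_filtration F (Gr n) p + induced_filtration G (Gr n) q = W n"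
    using plus_subset_subspace[OF W_subspace induced_F(3) induced_G(3)] by (rule subset_antisym[rotated])
  thus ?thesis
    using dim_plus_eq[OF induced_F(1) induced_G(1), of n p n q] by (simp add: bifiltered_dim_def)
qed

text \<open>The arguments involved have sums from p + q to p + q + 2. If p + q < n, all are at most
  n + 1; if p + q > n, all are at least n + 1. Both preceding lemmas include the value n + 1, so one
  of them covers all four terms.\<close>

lemma mixed_difference_gr_dim_eq_0:
  assumes "p + q \<noteq> n" shows "mixed_difference (gr_dim n) p q = 0"
proof (cases "p + q < n")
  case True
  thus ?thesis by (simp add: mixed_difference_def gr_dim_below)
next
  case False
  thus ?thesis using assms by (simp add: mixed_difference_def gr_dim_above)
qed

text \<open>Outside \<open>{lo<..hi}\<close> the graded piece is zero: \<open>W n\<close> and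
  \<open>W (n - 1)\<close> are both \<open>{0}\<close> up to \<open>lo\<close> and both the whole
  space after \<open>hi\<close>.\<close>

lemma gr_dim_trivial_step:
  assumes "n \<notin> {lo<..hi}" shows "gr_dim n p q = 0"
proof -
  have "W n = W (n - 1)"
  proof (cases "n \<le> lo")
    case True
    hence "W n \<subseteq> {0}" "W (n - 1) \<subseteq> {0}"
      using W_increasing[of _ lo] W_bounds by auto
    thus ?thesis
      using subspace_0[OF W_subspace[of n]] subspace_0[OF W_subspace[of "n - 1"]] by blast
  next
    case False
    hence "UNIV \<subseteq> W n" "UNIV \<subseteq> W (n - 1)"
      using assms W_increasing[of hi] W_bounds by auto
    thus ?thesis by auto
  qed
  hence "induced_filtration F (Gr n) p \<inter> induced_filtration G (Gr n) q = W (n - 1)"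
    using induced_F(2,3)[of n p] induced_G(2,3)[of n q] by auto
  thus ?thesis by (simp add: bifiltered_dim_def)
qed

section \<open>The defect: difference formula, sign and support\<close>

definition defect :: "int \<Rightarrow> int \<Rightarrow> int" where
  "defect p q = (\<Sum>n\<in>{lo<..hi}. gr_dim n p q) - int (dim (F p \<inter> G q))"

text \<open>All weights other than p + q contribute zero. Summing over them removes the dependence
  of the graded piece on \<open>p\<close> and \<open>q\<close>, so that one function of two
  variables is being differenced.\<close>

lemma bigraded_dim_Gr:
  "bigraded_dim F G (Gr (p + q)) p q = (\<Sum>n\<in>{lo<..hi}. mixed_difference (gr_dim n) p q)"
proof -
  have "bigraded_dim F G (Gr (p + q)) p q = mixed_difference (gr_dim (p + q)) p q"
    by (intro bigraded_dim_eq_mixed_difference)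
       (simp_all add: W_subspace F_subspace G_subspace W_step F_decreasing)
  moreover have "mixed_difference (gr_dim (p + q)) p q = 0" if "p + q \<notin> {lo<..hi}"
    unfolding mixed_difference_def gr_dim_trivial_step[OF that] by simp
  moreover have "(\<Sum>n\<in>{lo<..hi}. mixed_difference (gr_dim n) p q) =
      (\<Sum>n\<in>{lo<..hi}. if p + q = n then mixed_difference (gr_dim n) p q else 0)"
    by (intro sum.cong refl) (use mixed_difference_gr_dim_eq_0 in auto)
  ultimately show ?thesis by auto
qed

lemma bifiltered_dim_UNIV: "bifiltered_dim F G (UNIV, {0}) p q = int (dim (F p \<inter> G q))"
  unfolding bifiltered_dim_def induced_filtration_def by simp

lemma bigraded_dim_diff:
  "bigraded_dim F G (Gr (p + q)) p q - bigraded_dim F G (UNIV, {0}) p q = mixed_difference defect p q"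
proof -
  have "bigraded_dim F G (UNIV, {0}) p q = mixed_difference (bifiltered_dim F G (UNIV, {0})) p q"
    by (intro bigraded_dim_eq_mixed_difference)
       (simp_all add: F_subspace G_subspace F_decreasing)
  thus ?thesis
    unfolding bigraded_dim_Gr
    by (simp add: mixed_difference_def defect_def bifiltered_dim_UNIV sum.distrib sum_subtractf)
qed

lemma sum_dim_Int_W:
  "(\<Sum>n\<in>{lo<..hi}. int (dim (X \<inter> W n)) - int (dim (X \<inter> W (n - 1)))) = int (dim X)"
  if "subspace X"
proof -
  have "X \<inter> W lo = {0}" using subspace_0[OF that] W_bounds by simp
  thus ?thesis
    using sum_telescope_int[OF lo_le_hi, of "\<lambda>n. int (dim (X \<inter> W n))"] W_bounds by simp
qed

text \<open>The map from \<open>X \<inter> W n\<close> to the n-th graded piece has kernel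
  \<open>X \<inter> W (n - 1)\<close>; the left side is the dimension of its image.\<close>

lemma dim_Gr_image:
  assumes "subspace X"
  shows "int (dim ((X \<inter> W n) + W (n - 1))) - int (dim (W (n - 1))) =
    int (dim (X \<inter> W n)) - int (dim (X \<inter> W (n - 1)))"
proof -
  have "X \<inter> W n \<inter> W (n - 1) = X \<inter> W (n - 1)" using W_step by auto
  thus ?thesis
    using dim_plus_eq[of "X \<inter> W n" "W (n - 1)"] assms W_subspace by (simp add: subspace_inter)
qed

text \<open>Only an inequality holds in general, because a class in both induced steps need not lift
  to a single element of \<open>F p \<inter> G q\<close>.\<close>

lemma defect_nonneg: "defect p q \<ge> 0"
proof -
  let ?X = "F p \<inter> G q"
  have X: "subspace ?X" by (simp add: F_subspace G_subspace subspace_inter)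
  have "int (dim (?X \<inter> W n)) - int (dim (?X \<inter> W (n - 1))) \<le> gr_dim n p q" for n
  proof -
    have "(?X \<inter> W n) + W (n - 1) \<subseteq> induced_filtration F (Gr n) p \<inter> induced_filtration G (Gr n) q"
      unfolding induced_filtration_def by (intro Int_greatest set_plus_mono2) auto
    hence "dim ((?X \<inter> W n) + W (n - 1)) \<le> dim (induced_filtration F (Gr n) p \<inter> induced_filtration G (Gr n) q)"
      by (rule dim_subset)
    thus ?thesis
      using dim_Gr_image[OF X, of n] by (simp add: bifiltered_dim_def)
  qed
  hence "int (dim ?X) \<le> (\<Sum>n\<in>{lo<..hi}. gr_dim n p q)"
    unfolding sum_dim_Int_W[OF X, symmetric] by (rule sum_mono)
  thus ?thesis by (simp add: defect_def)
qed

text \<open>Below \<open>lo\<close> the step of \<open>F\<close> is everything, and the dimensions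
  of \<open>G q\<close> on the graded pieces telescope to that of \<open>G q\<close>; above
  \<open>hi\<close> both terms vanish. The bound on \<open>q\<close> comes from swapping
  \<open>F\<close> and \<open>G\<close>.\<close>

lemma defect_eq_0:
  assumes "p \<notin> {lo..hi}" shows "defect p q = 0"
proof (cases "p < lo")
  case True
  hence Fp: "F p = UNIV" using F_decreasing[of p lo] F_bounds by auto
  have "induced_filtration F (Gr n) p = W n" for n
    using induced_F(3)[of n p] Fp set_zero_plus2[of "W (n - 1)" "W n"] W_subspace[THEN subspace_0]
    by (auto simp: induced_filtration_def add.commute)
  hence "induced_filtration F (Gr n) p \<inter> induced_filtration G (Gr n) q = induced_filtration G (Gr n) q" for n
    using induced_G(3)[of n q] by (simp add: Int_absorb1)
  hence "gr_dim n p q = int (dim (G q \<inter> W n)) - int (dim (G q \<inter> W (n - 1)))" for n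
    using dim_Gr_image[OF G_subspace, of q n] by (simp add: bifiltered_dim_def induced_filtration_def[of G])
  thus ?thesis
    using sum_dim_Int_W[OF G_subspace] Fp by (simp add: defect_def)
next
  case False
  hence "F p \<subseteq> {0}" using assms F_decreasing[of hi p] F_bounds by auto
  hence Fp: "F p = {0}" using F_subspace[THEN subspace_0, of p] by auto
  have "induced_filtration F (Gr n) p = W (n - 1)" for n
    using Fp W_subspace[THEN subspace_0]
    by (simp add: induced_filtration_def)
  hence "gr_dim n p q = 0" for n
    using induced_G(2) by (simp add: bifiltered_dim_def Int_absorb2)
  moreover have "F p \<inter> G q = {0}" using Fp G_subspace[THEN subspace_0] by auto
  ultimately show ?thesis by (simp add: defect_def)
qed

lemma defect_swap: "opposed_filtrations.defect scale W G F lo hi q p = defect p q"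
  unfolding defect_def opposed_filtrations.defect_def[OF opposed_filtrations_swap]
  by (simp add: bifiltered_dim_commute[of G] Int_commute)

lemma finite_support_defect: "finite {(p, q). defect p q \<noteq> 0}"
proof (rule finite_subset)
  show "{(p, q). defect p q \<noteq> 0} \<subseteq> {lo..hi} \<times> {lo..hi}"
    using defect_eq_0 opposed_filtrations.defect_eq_0[OF opposed_filtrations_swap]
    unfolding defect_swap by blast
qed simp

text \<open>Both terms of the defect equal the full dimension for all very negative \<open>p\<close>
  and \<open>q\<close>; only their difference has finite support, so the summation by parts is
  applied to it. Its factor 2 cancels the 1/2.\<close>

theorem splitting_level_eq_sum_defect:
  "1 / 2 * Sum_any (\<lambda>(p, q). real_of_int ((p + q)\<^sup>2 *
      (bigraded_dim F G (Gr (p + q)) p q - bigraded_dim F G (UNIV, {0}) p q))) =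
    Sum_any (\<lambda>(p, q). real_of_int (defect p q))"
proof -
  let ?D = "\<lambda>p q. real_of_int (defect p q)"
  have "finite {x. case_prod ?D x \<noteq> 0}"
    using finite_support_defect by (simp add: case_prod_unfold)
  from Sum_any_square_mixed_difference[OF this] show ?thesis
    by (simp add: bigraded_dim_diff mixed_difference_def)
qed

corollary splitting_level_nonneg:
  "1 / 2 * Sum_any (\<lambda>(p, q). real_of_int ((p + q)\<^sup>2 *
      (bigraded_dim F G (Gr (p + q)) p q - bigraded_dim F G (UNIV, {0}) p q))) \<ge> 0"
  unfolding splitting_level_eq_sum_defect
  unfolding Sum_any.expand_set
  by (intro sum_nonneg) (auto simp: defect_nonneg)

end

section \<open>Conjugation\<close>

context complexification
begin

lemma conjugation_conjugation: "conjugation (conjugation x) = x"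
proof -
  obtain a b where x: "a \<in> real_form" "b \<in> real_form" "x = a + scaleC \<i> b"
    using real_form_decomposition by blast
  interpret R: vector_space "\<lambda>r :: real. scaleC (complex_of_real r)" by (rule real_module)
  have "- b \<in> real_form" using x unfolding real_form_def by (auto intro: R.span_neg)
  from conjugation_eq[OF x(1) this] show ?thesis
    using x by (simp add: conjugation_eq)
qed

lemma conjugation_0: "conjugation 0 = 0"
  using conjugation_add[of 0 0] by simp

lemma inj_conjugation: "inj conjugation"
  by (metis conjugation_conjugation injI)

lemma conjugation_image_plus: "conjugation ` (A + B) = conjugation ` A + conjugation ` B"
  by (force simp: set_plus_def conjugation_add image_iff)

lemma subspace_conjugation_image:
  assumes "C.subspace A" shows "C.subspace (conjugation ` A)"
proof (rule C.subspaceI)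
  show "0 \<in> conjugation ` A"
    using C.subspace_0[OF assms] conjugation_0 by force
  show "x + y \<in> conjugation ` A" if "x \<in> conjugation ` A" "y \<in> conjugation ` A" for x y
    using that C.subspace_add[OF assms] by (auto simp flip: conjugation_add)
  show "scaleC c x \<in> conjugation ` A" if x: "x \<in> conjugation ` A" for c x
  proof -
    obtain y where y: "x = conjugation y" "y \<in> A" using x by auto
    have "scaleC c x = conjugation (scaleC (cnj c) y)" by (simp add: conjugation_scale y)
    thus ?thesis using y C.subspace_scale[OF assms] by blast
  qed
qed

text \<open>The weight steps are spanned by rational vectors, which conjugation fixes. This gives
  one inclusion, and applying the involution to it gives the other.\<close>

lemma conjugation_image_weight_filtration:
  "conjugation ` weight_filtration_C W n = weight_filtration_C W n"
proof -
  let ?W = "weight_filtration_C W n"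
  have "\<iota> ` W n \<subseteq> conjugation ` ?W"
  proof
    fix x assume "x \<in> \<iota> ` W n"
    thus "x \<in> conjugation ` ?W"
      unfolding weight_filtration_C_def
      by (metis C.span_base conjugation_\<iota> image_iff)
  qed
  hence sub: "?W \<subseteq> conjugation ` ?W"
    unfolding weight_filtration_C_def
    by (intro C.span_minimal subspace_conjugation_image C.subspace_span)
  hence "conjugation ` ?W \<subseteq> conjugation ` conjugation ` ?W" by blast
  thus ?thesis using sub by (auto simp: image_image conjugation_conjugation)
qed

text \<open>Purity speaks of the conjugate of an induced filtration, opposedness of the filtration
  induced by the conjugate; this identifies the two.\<close>

lemma conjugation_image_induced_filtration:
  assumes "conjugation ` fst S = fst S" "conjugation ` snd S = snd S"
  shows "conjugation ` induced_filtration F S p = induced_filtration (conjugate_filtration F) S p"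
  unfolding induced_filtration_def conjugation_image_plus image_Int[OF inj_conjugation]
  by (simp add: assms conjugate_filtration_def)

end

section \<open>From a mixed Hodge structure to three opposed filtrations\<close>

context mixed_Hodge_structure
begin

lemma ex_finite_basis_C: "\<exists>B. finite B \<and> C.independent B \<and> C.span B = UNIV"
proof -
  obtain B where B: "finite B" "Q.span B = UNIV" using finite_dimensional by blast
  obtain B' where B': "B' \<subseteq> \<iota> ` B" "C.independent B'" "\<iota> ` B \<subseteq> C.span B'"
    using C.maximal_independent_subset[of "\<iota> ` B"] by auto
  have "C.span (\<iota> ` B) \<subseteq> C.span B'" using B'(3) by (simp add: C.span_minimal)
  thus ?thesis
    using B B' span_\<iota>_basis[OF B(2)] finite_subset[OF B'(1)] by auto
qed

lemma opposed_filtrations: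
  "\<exists>Basis lo hi. opposed_filtrations scaleC Basis (weight_filtration_C W) F (conjugate_filtration F) lo hi"
proof -
  let ?W = "weight_filtration_C W" and ?G = "conjugate_filtration F"
  obtain Basis where Basis: "finite Basis" "C.independent Basis" "C.span Basis = UNIV"
    using ex_finite_basis_C by blast
  obtain w0 w1 f0 f1 where b: "W w0 = {0}" "W w1 = UNIV" "F f0 = UNIV" "F f1 = {0}"
    using W_separated W_exhaustive F_separated F_exhaustive by metis
  \<comment> \<open>The given indices come in no known order (in the zero space \<open>w1\<close>
    may lie below \<open>w0\<close>); minimum and maximum force \<open>lo \<le> hi\<close>.\<close>
  define lo where "lo = min (min w0 w1) (min f0 f1)"
  define hi where "hi = max (max w0 w1) (max f0 f1)"
  have Gr: "conjugation ` induced_filtration F (?W n, ?W (n - 1)) p = induced_filtration ?G (?W n, ?W (n - 1)) p"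
    for n p
    by (intro conjugation_image_induced_filtration) (simp_all add: conjugation_image_weight_filtration)
  have "W lo \<subseteq> {0}" "UNIV \<subseteq> W hi" "UNIV \<subseteq> F lo" "F hi \<subseteq> {0}"
    unfolding b[symmetric] lo_def hi_def by (auto intro!: W_increasing F_decreasing)
  hence bounds: "W lo = {0}" "W hi = UNIV" "F lo = UNIV" "F hi = {0}"
    using Q.subspace_0[OF W_subspace] C.subspace_0[OF F_subspace] by blast+
  have UNIV_conj: "conjugation ` UNIV = UNIV"
    by (metis conjugation_conjugation surjI)
  have lo_le_hi: "lo \<le> hi" by (simp add: lo_def hi_def)
  have "opposed_filtrations scaleC Basis ?W F ?G lo hi"
  proof unfold_locales
    show "?W m \<subseteq> ?W n" if "m \<le> n" for m n
      unfolding weight_filtration_C_def by (intro C.span_mono image_mono W_increasing that)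
    show "?W lo = {0}" "?W hi = UNIV"
      by (simp_all add: weight_filtration_C_def bounds \<iota>_zero \<iota>_spanning)
    show "?G p \<supseteq> ?G q" if "p \<le> q" for p q
      unfolding conjugate_filtration_def by (intro image_mono F_decreasing that)
    fix p q n :: int assume "p + q = n + 1"
    hence q: "q = n + 1 - p" by simp
    show "induced_filtration F (?W n, ?W (n - 1)) p + induced_filtration ?G (?W n, ?W (n - 1)) q = ?W n"
      "induced_filtration F (?W n, ?W (n - 1)) p \<inter> induced_filtration ?G (?W n, ?W (n - 1)) q = ?W (n - 1)"
      using Gr_W_pure[of n] unfolding pure_of_weight_def q Gr by auto
  qed (use Basis in \<open>simp_all add: weight_filtration_C_def conjugate_filtration_def bounds
      conjugation_0 UNIV_conj subspace_conjugation_image F_subspace F_decreasing lo_le_hi\<close>)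
  thus ?thesis by blast
qed

end

theorem mainTheorem5:
  fixes scaleQ :: "rat \<Rightarrow> 'a::ab_group_add \<Rightarrow> 'a"
    and scaleC :: "complex \<Rightarrow> 'b::ab_group_add \<Rightarrow> 'b"
    and \<iota> :: "'a \<Rightarrow> 'b"
    and W :: "int \<Rightarrow> 'a set"
    and F :: "int \<Rightarrow> 'b set"
  assumes "mixed_Hodge_structure scaleQ scaleC \<iota> W F"
  shows "mixed_Hodge_structure.R_splitting_level scaleC \<iota> W F \<ge> 0"
proof -
  interpret mixed_Hodge_structure scaleQ scaleC \<iota> W F by fact
  obtain Basis lo hi where
    "opposed_filtrations scaleC Basis (weight_filtration_C W) F (conjugate_filtration F) lo hi"
    using opposed_filtrations by blast
  from opposed_filtrations.splitting_level_nonneg[OF this] show ?thesis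
    \<comment> \<open>Unfolded, \<open>hodge_number p q\<close> is \<open>bigraded_dim\<close> on
      the graded piece of weight p + q, and \<open>total_number p q\<close> is
      \<open>bigraded_dim\<close> on \<open>(UNIV, {0})\<close>.\<close>
    by (simp add: R_splitting_level_def hodge_number_def total_number_def subquotient_dim_def
        C.bigraded_dim_def)
qed

end
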